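(* The local tangent cones of $M_\infty$ are isometric to Euclidean space $\mathbb E^3$ at almost every point of $M_\infty$.
   Context: Let $D,A>0$. For $j\in\mathbb N$, $M_j$ is diffeomorphic to $\mathbb S^3$ with a smooth rotationally symmetric metric $g_j=ds^2+f_j(s)^2g_{\mathbb S^2}$, $0\le s\le D_j$, where $g_{\mathbb S^2}$ is the round unit-sphere metric and $f_j$ is smooth on $[0,D_j]$ with $f_j(0)=f_j(D_j)=0$, $f_j>0$ on $(0,D_j)$, $f_j'(0)=1$, $f_j'(D_j)=-1$. Assume for all $j$ that $\operatorname{Diam}(M_j)\le D$ (so $D_j\le D$), $\operatorname{Scalar}_j\ge0$, and $\operatorname{MinA}(M_j)\ge A>0$, where $\operatorname{MinA}(M_j)$ is the infimum of areas of closed embedded minimal surfaces in $M_j$. Extend $f_j$ by $0$ to $[D_j,D]$. After passing to a subsequence, $f_j$ converges uniformly on $[0,D]$ to a function $f_\infty$ which is Lipschitz with constant $1$. Set $a_\infty=\sup\{s: f_\infty=0\text{ on }[0,s]\}$ and $b_\infty=\inf\{s: f_\infty=0\text{ on }[s,D]\}$; then $\{f_\infty>0\}=(a_\infty,b_\infty)$ and $f_\infty(a_\infty)=f_\infty(b_\infty)=0$. The limit space is $M_\infty=[a_\infty,b_\infty]\times\mathbb S^2$ (end slices collapsed to points, so it is topologically $\mathbb S^3$) with the continuous metric tensor $g_\infty=ds^2+f_\infty(s)^2g_{\mathbb S^2}$ and the induced length distance $d_\infty$. The local tangent cone at $p$ is the pointed Gromov–Hausdorff limit of $(M_\infty,d_\infty/r,p)$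 as $r\to0^+$. "Almost every" refers to the volume measure of $g_\infty$, $f_\infty^2\,ds\,d\mathrm{vol}_{\mathbb S^2}$. *)

theory Defs
  imports "HOL-Analysis.Analysis"
begin

section \<open>Smooth maps\<close>

primrec iterated_derivative ::
    "'a::euclidean_space list \<Rightarrow> ('a \<Rightarrow> 'b::real_normed_vector) \<Rightarrow> 'a \<Rightarrow> 'b" where
  "iterated_derivative [] F = F"
| "iterated_derivative (v # vs) F = iterated_derivative vs (\<lambda>x. frechet_derivative F (at x) v)"

text \<open>Intended for open \<open>S\<close>: all iterated partial derivatives exist and are differentiable,
  hence also continuous.\<close>

definition smooth_on :: "'a::euclidean_space set \<Rightarrow> ('a \<Rightarrow> 'b::real_normed_vector) \<Rightarrow> bool" where
  "smooth_on S F \<longleftrightarrow>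
     (\<forall>vs. set vs \<subseteq> Basis \<longrightarrow> (\<forall>x\<in>S. iterated_derivative vs F differentiable (at x)))"


section \<open>Riemannian geometry in a coordinate domain\<close>

text \<open>A metric on an open subset of Euclidean space is given by its Gram matrix \<open>G x\<close>.\<close>

definition partial_deriv ::
    "'n::finite \<Rightarrow> (real^'n \<Rightarrow> 'b::real_normed_vector) \<Rightarrow> real^'n \<Rightarrow> 'b" where
  "partial_deriv k F x = frechet_derivative F (at x) (axis k 1)"

definition christoffel ::
    "(real^'n \<Rightarrow> real^'n^'n) \<Rightarrow> 'n::finite \<Rightarrow> 'n \<Rightarrow> 'n \<Rightarrow> real^'n \<Rightarrow> real" where
  "christoffel G k i j x =
     (1/2) * (\<Sum>l\<in>UNIV. matrix_inv (G x) $ k $ l *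
       (partial_deriv i (\<lambda>y. G y $ j $ l) x + partial_deriv j (\<lambda>y. G y $ i $ l) x
        - partial_deriv l (\<lambda>y. G y $ i $ j) x))"

text \<open>\<open>riemann_curvature G l k i j\<close> is the coefficient of the \<open>l\<close>-th coordinate field in
  \<open>R(\<partial>\<^sub>i, \<partial>\<^sub>j) \<partial>\<^sub>k\<close>, with the sign convention
  \<open>R(V, W) = \<nabla>\<^sub>V \<nabla>\<^sub>W - \<nabla>\<^sub>W \<nabla>\<^sub>V - \<nabla>\<^sub>[\<^sub>V\<^sub>,\<^sub>W\<^sub>]\<close>.\<close>

definition riemann_curvature ::
    "(real^'n \<Rightarrow> real^'n^'n) \<Rightarrow> 'n::finite \<Rightarrow> 'n \<Rightarrow> 'n \<Rightarrow> 'n \<Rightarrow> real^'n \<Rightarrow> real" where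
  "riemann_curvature G l k i j x =
     partial_deriv i (christoffel G l j k) x - partial_deriv j (christoffel G l i k) x
     + (\<Sum>m\<in>UNIV. christoffel G l i m x * christoffel G m j k x
                - christoffel G l j m x * christoffel G m i k x)"

definition ricci_curvature ::
    "(real^'n \<Rightarrow> real^'n^'n) \<Rightarrow> 'n::finite \<Rightarrow> 'n \<Rightarrow> real^'n \<Rightarrow> real" where
  "ricci_curvature G j k x = (\<Sum>i\<in>UNIV. riemann_curvature G i k i j x)"

definition scalar_curvature :: "(real^'n \<Rightarrow> real^'n^'n) \<Rightarrow> real^'n::finite \<Rightarrow> real" where
  "scalar_curvature G x =
     (\<Sum>j\<in>UNIV. \<Sum>k\<in>UNIV. matrix_inv (G x) $ j $ k * ricci_curvature G j k x)"


section \<open>Surfaces in a three-dimensional coordinate domain\<close>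

definition surface_patch ::
    "(real^3) set \<Rightarrow> (real^2) set \<Rightarrow> (real^2 \<Rightarrow> real^3) \<Rightarrow> bool" where
  "surface_patch S U X \<longleftrightarrow>
     open U \<and> smooth_on U X \<and> X ` U \<subseteq> S \<and> openin (top_of_set S) (X ` U) \<and>
     (\<exists>Y. homeomorphism U (X ` U) X Y) \<and> (\<forall>u\<in>U. inj (frechet_derivative X (at u)))"

definition embedded_surface :: "(real^3) set \<Rightarrow> bool" where
  "embedded_surface S \<longleftrightarrow> (\<forall>p\<in>S. \<exists>U X. surface_patch S U X \<and> p \<in> X ` U)"

definition first_fundamental_form ::
    "(real^3 \<Rightarrow> real^3^3) \<Rightarrow> (real^2 \<Rightarrow> real^3) \<Rightarrow> real^2 \<Rightarrow> real^2^2" where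
  "first_fundamental_form G X u =
     (\<chi> i j. partial_deriv i X u \<bullet> (G (X u) *v partial_deriv j X u))"

text \<open>The ambient covariant derivative of the field \<open>\<partial>\<^sub>j X\<close> in direction \<open>\<partial>\<^sub>i X\<close>.\<close>

definition covariant_hessian ::
    "(real^3 \<Rightarrow> real^3^3) \<Rightarrow> (real^2 \<Rightarrow> real^3) \<Rightarrow> 2 \<Rightarrow> 2 \<Rightarrow> real^2 \<Rightarrow> real^3" where
  "covariant_hessian G X i j u =
     partial_deriv i (partial_deriv j X) u
     + (\<chi> k. \<Sum>a\<in>UNIV. \<Sum>b\<in>UNIV.
          christoffel G k a b (X u) * partial_deriv i X u $ a * partial_deriv j X u $ b)"

definition mean_curvature ::
    "(real^3 \<Rightarrow> real^3^3) \<Rightarrow> (real^2 \<Rightarrow> real^3) \<Rightarrow> real^2 \<Rightarrow> real^3 \<Rightarrow> real" where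
  "mean_curvature G X u \<nu> =
     (\<Sum>i\<in>UNIV. \<Sum>j\<in>UNIV. matrix_inv (first_fundamental_form G X u) $ i $ j *
        (covariant_hessian G X i j u \<bullet> (G (X u) *v \<nu>)))"

definition minimal_surface :: "(real^3 \<Rightarrow> real^3^3) \<Rightarrow> (real^3) set \<Rightarrow> bool" where
  "minimal_surface G S \<longleftrightarrow>
     embedded_surface S \<and>
     (\<forall>U X u \<nu>. surface_patch S U X \<and> u \<in> U \<and>
        (\<forall>i. partial_deriv i X u \<bullet> (G (X u) *v \<nu>) = 0)
        \<longrightarrow> mean_curvature G X u \<nu> = 0)"

text \<open>The Riemannian area integral, taken over finitely many patches with disjoint images. The
  supremum is the area of the surface because a triangulation covers any compact part of it, up to
  a null set, by finitely many disjoint patches.\<close>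

definition surface_area :: "(real^3 \<Rightarrow> real^3^3) \<Rightarrow> (real^3) set \<Rightarrow> ennreal" where
  "surface_area G S =
     Sup {(\<Sum>(U, X)\<in>P. \<integral>\<^sup>+u\<in>U. ennreal (sqrt (det (first_fundamental_form G X u))) \<partial>lborel) | P.
            finite P \<and> (\<forall>(U, X)\<in>P. surface_patch S U X) \<and>
            pairwise (\<lambda>(U, X) (V, Y). X ` U \<inter> Y ` V = {}) P}"


section \<open>Warped products over an interval with collapsed ends\<close>

text \<open>Points of \<open>[a,b] \<times> S\<^sup>2\<close> with the two end slices collapsed are written \<open>(s, \<theta>)\<close> with
  \<open>\<theta>\<close> a unit vector if \<open>a < s < b\<close>, and \<open>(a, 0)\<close>, \<open>(b, 0)\<close> for the two poles.\<close>

definition collapse :: "real \<Rightarrow> real \<Rightarrow> real \<times> (real^3) \<Rightarrow> real \<times> (real^3)" where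
  "collapse a b = (\<lambda>(s, \<theta>). (s, if a < s \<and> s < b then \<theta> else 0))"

definition warped_space :: "real \<Rightarrow> real \<Rightarrow> (real \<times> (real^3)) set" where
  "warped_space a b = collapse a b ` ({a..b} \<times> sphere 0 1)"

text \<open>Speed of a curve in \<open>[a,b] \<times> S\<^sup>2\<close> for the metric tensor \<open>ds\<^sup>2 + f(s)\<^sup>2 g\<close>, \<open>g\<close> the round
  metric.\<close>

definition warped_speed :: "(real \<Rightarrow> real) \<Rightarrow> (real \<Rightarrow> real \<times> (real^3)) \<Rightarrow> real \<Rightarrow> real" where
  "warped_speed f \<gamma> t =
     (let v = vector_derivative \<gamma> (at t)
      in sqrt ((fst v)\<^sup>2 + (f (fst (\<gamma> t)))\<^sup>2 * (norm (snd v))\<^sup>2))"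

text \<open>Length distance. Curves are taken before collapsing: where \<open>f\<close> vanishes at an end, motion in
  the end slice costs nothing, so a curve through a pole is one that turns inside that slice. The
  integrability condition excludes curves of infinite length, as the derivative of a valid path may
  be unbounded near its exceptional points.\<close>

definition warped_dist ::
    "real \<Rightarrow> real \<Rightarrow> (real \<Rightarrow> real) \<Rightarrow> real \<times> (real^3) \<Rightarrow> real \<times> (real^3) \<Rightarrow> real" where
  "warped_dist a b f p q =
     Inf {integral {0..1} (warped_speed f \<gamma>) | \<gamma>.
            valid_path \<gamma> \<and> path_image \<gamma> \<subseteq> {a..b} \<times> sphere 0 1 \<and>
            warped_speed f \<gamma> integrable_on {0..1} \<and>
            collapse a b (pathstart \<gamma>) = p \<and> collapse a b (pathfinish \<gamma>) = q}"

definition warped_diameter :: "real \<Rightarrow> real \<Rightarrow> (real \<Rightarrow> real) \<Rightarrow> ereal" where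
  "warped_diameter a b f =
     (SUP p\<in>warped_space a b. SUP q\<in>warped_space a b. ereal (warped_dist a b f p q))"

text \<open>Riemannian volume of the round unit sphere, in spherical coordinates.\<close>

definition sphere_measure :: "(real^3) measure" where
  "sphere_measure =
     distr (density lborel (\<lambda>(\<phi>, \<psi>). ennreal (indicator ({0..pi} \<times> {0..2*pi}) (\<phi>, \<psi>) * sin \<phi>)))
       borel (\<lambda>(\<phi>, \<psi>). vector [sin \<phi> * cos \<psi>, sin \<phi> * sin \<psi>, cos \<phi>])"

definition warped_volume :: "real \<Rightarrow> real \<Rightarrow> (real \<Rightarrow> real) \<Rightarrow> (real \<times> (real^3)) measure" where
  "warped_volume a b f =
     distr (density (lborel \<Otimes>\<^sub>M sphere_measure) (\<lambda>(s, \<theta>). ennreal (indicator {a..b} s * (f s)\<^sup>2)))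
       borel (collapse a b)"


section \<open>Rotationally symmetric metrics on the three-sphere\<close>

text \<open>The pullback of \<open>ds\<^sup>2 + f(s)\<^sup>2 g\<close> under \<open>x \<mapsto> (|x|, x/|x|)\<close>, a metric tensor around a
  pole in Cartesian coordinates; \<open>polar_ds x\<close> and \<open>polar_dtheta x\<close> are the differentials of \<open>|x|\<close>
  and \<open>x/|x|\<close>.\<close>

definition polar_ds :: "real^3 \<Rightarrow> real^3 \<Rightarrow> real" where
  "polar_ds x u = u \<bullet> sgn x"

definition polar_dtheta :: "real^3 \<Rightarrow> real^3 \<Rightarrow> real^3" where
  "polar_dtheta x u = (u - (u \<bullet> sgn x) *\<^sub>R sgn x) /\<^sub>R norm x"

definition polar_metric :: "(real \<Rightarrow> real) \<Rightarrow> real^3 \<Rightarrow> real^3^3" where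
  "polar_metric f x =
     (if x = 0 then mat 1
      else \<chi> i j. polar_ds x (axis i 1) * polar_ds x (axis j 1)
             + (f (norm x))\<^sup>2 * (polar_dtheta x (axis i 1) \<bullet> polar_dtheta x (axis j 1)))"

text \<open>For \<open>f\<close> on \<open>[0,L]\<close> the manifold \<open>warped_space 0 L\<close> is covered by two such charts on the ball
  of radius \<open>L\<close>, centred at the poles \<open>s = 0\<close> and \<open>s = L\<close>. In the second chart the metric is
  \<open>polar_metric (\<lambda>s. f (L - s))\<close>. At the centre, \<open>sgn 0 = 0\<close> gives the representation of the
  pole used in \<open>warped_space\<close>.\<close>

definition chart_0 :: "real^3 \<Rightarrow> real \<times> (real^3)" where
  "chart_0 x = (norm x, sgn x)"

definition chart_1 :: "real \<Rightarrow> real^3 \<Rightarrow> real \<times> (real^3)" where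
  "chart_1 L x = (L - norm x, sgn x)"

definition rot_sym_sphere :: "(real \<Rightarrow> real) \<Rightarrow> real \<Rightarrow> bool" where
  "rot_sym_sphere f L \<longleftrightarrow>
     L > 0 \<and>
     (\<exists>F. smooth_on UNIV F \<and> (\<forall>s\<in>{0..L}. F s = f s)) \<and>
     f 0 = 0 \<and> f L = 0 \<and> (\<forall>s\<in>{0<..<L}. f s > 0) \<and>
     (f has_real_derivative 1) (at 0 within {0..L}) \<and>
     (f has_real_derivative -1) (at L within {0..L}) \<and>
     smooth_on (ball 0 L) (polar_metric f) \<and>
     smooth_on (ball 0 L) (polar_metric (\<lambda>s. f (L - s)))"

definition nonneg_scalar_curvature :: "(real \<Rightarrow> real) \<Rightarrow> real \<Rightarrow> bool" where
  "nonneg_scalar_curvature f L \<longleftrightarrow>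
     (\<forall>x\<in>ball 0 L. scalar_curvature (polar_metric f) x \<ge> 0 \<and>
                   scalar_curvature (polar_metric (\<lambda>s. f (L - s))) x \<ge> 0)"

text \<open>Since the sphere is compact, a surface without boundary is closed (as a manifold) iff it is a
  closed subset, and this can be tested in the two charts.\<close>

definition closed_embedded_minimal_surface ::
    "(real \<Rightarrow> real) \<Rightarrow> real \<Rightarrow> (real \<times> (real^3)) set \<Rightarrow> bool" where
  "closed_embedded_minimal_surface f L \<Sigma> \<longleftrightarrow>
     \<Sigma> \<noteq> {} \<and> \<Sigma> \<subseteq> warped_space 0 L \<and>
     (let S0 = {x\<in>ball 0 L. chart_0 x \<in> \<Sigma>}; S1 = {x\<in>ball 0 L. chart_1 L x \<in> \<Sigma>}
      in closedin (top_of_set (ball 0 L)) S0 \<and> closedin (top_of_set (ball 0 L)) S1 \<and>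
         minimal_surface (polar_metric f) S0 \<and> minimal_surface (polar_metric (\<lambda>s. f (L - s))) S1)"

text \<open>The infimum of the areas. The chart around \<open>s = 0\<close> suffices for the area: it misses a single
  point.\<close>

definition MinA :: "(real \<Rightarrow> real) \<Rightarrow> real \<Rightarrow> ennreal" where
  "MinA f L =
     Inf {surface_area (polar_metric f) {x\<in>ball 0 L. chart_0 x \<in> \<Sigma>} | \<Sigma>.
            closed_embedded_minimal_surface f L \<Sigma>}"


section \<open>The limit space\<close>

definition extend_by_zero :: "real \<Rightarrow> (real \<Rightarrow> real) \<Rightarrow> real \<Rightarrow> real" where
  "extend_by_zero L f s = (if s \<le> L then f s else 0)"

definition left_end :: "real \<Rightarrow> (real \<Rightarrow> real) \<Rightarrow> real" where
  "left_end D f = Sup {s\<in>{0..D}. \<forall>t\<in>{0..s}. f t = 0}"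

definition right_end :: "real \<Rightarrow> (real \<Rightarrow> real) \<Rightarrow> real" where
  "right_end D f = Inf {s\<in>{0..D}. \<forall>t\<in>{s..D}. f t = 0}"


section \<open>Pointed Gromov--Hausdorff limits and tangent cones\<close>

text \<open>Pointed convergence as in Burago--Burago--Ivanov, Definition 8.1.1, along a filter: maps of
  balls of radius \<open>R\<close>, not necessarily continuous, that preserve the base point, have distortion
  less than \<open>\<epsilon>\<close>, and whose image is \<open>\<epsilon>\<close>-dense in the ball of radius \<open>R - \<epsilon>\<close>.\<close>

definition pointed_GH_limit ::
    "('i \<Rightarrow> 'a set) \<Rightarrow> ('i \<Rightarrow> 'a \<Rightarrow> 'a \<Rightarrow> real) \<Rightarrow> ('i \<Rightarrow> 'a) \<Rightarrow>
     'b set \<Rightarrow> ('b \<Rightarrow> 'b \<Rightarrow> real) \<Rightarrow> 'b \<Rightarrow> 'i filter \<Rightarrow> bool" where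
  "pointed_GH_limit M d p X e x F \<longleftrightarrow>
     (\<forall>R>0. \<forall>\<epsilon>>0. \<forall>\<^sub>F i in F.
        let B = {y\<in>M i. d i (p i) y < R}
        in \<exists>\<phi>. \<phi> ` B \<subseteq> X \<and> \<phi> (p i) = x \<and>
             (\<exists>\<delta><\<epsilon>. \<forall>y\<in>B. \<forall>z\<in>B. \<bar>e (\<phi> y) (\<phi> z) - d i y z\<bar> \<le> \<delta>) \<and>
             (\<forall>w\<in>X. e x w < R - \<epsilon> \<longrightarrow> (\<exists>y\<in>B. e w (\<phi> y) < \<epsilon>)))"

definition is_tangent_cone ::
    "'a set \<Rightarrow> ('a \<Rightarrow> 'a \<Rightarrow> real) \<Rightarrow> 'a \<Rightarrow> 'b set \<Rightarrow> ('b \<Rightarrow> 'b \<Rightarrow> real) \<Rightarrow> 'b \<Rightarrow> bool" where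
  "is_tangent_cone M d p X e x \<longleftrightarrow>
     pointed_GH_limit (\<lambda>r. M) (\<lambda>r y z. d y z / r) (\<lambda>r. p) X e x (at_right (0::real))"

end

theory Submission
  imports Defs
begin

text \<open>The volume measure has density \<open>f\<^sup>2\<close> with respect to \<open>ds d\<theta>\<close>, so almost every point is a pair
  \<open>(s\<^sub>0, \<theta>\<^sub>0)\<close> with \<open>a < s\<^sub>0 < b\<close>, \<open>\<bar>\<theta>\<^sub>0\<bar> = 1\<close> and \<open>f s\<^sub>0 \<noteq> 0\<close>. At each such point the tangent cone
  is Euclidean because \<open>f\<close> is continuous there: put \<open>c = \<bar>f s\<^sub>0\<bar>\<close> and \<open>m = s\<^sub>0 - c\<close>. The metric
  \<open>ds\<^sup>2 + (s - m)\<^sup>2 g\<close> is the flat metric of \<open>\<real>\<^sup>3\<close> in polar coordinates with radius \<open>s - m\<close>, and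
  at \<open>s = s\<^sub>0\<close> its warping function has the value \<open>c\<close>. Given \<open>K > 1\<close>, the functions \<open>\<bar>f s\<bar>\<close> and
  \<open>s - m\<close> differ by at most the factor \<open>K\<close> near \<open>s\<^sub>0\<close>. Hence the map \<open>(s, \<theta>) \<mapsto> (s - m) \<theta>\<close> changes
  lengths of curves near the point by at most the factor \<open>K\<close>.

  To pass from curves to distances, one needs both directions. A Euclidean segment pulls back to a
  curve in the warped product, which gives \<open>d \<le> K \<bar>x - y\<bar>\<close> (lemma
  \<open>warped_dist_polar_inverse_le\<close>). Conversely a curve of almost minimal length cannot leave the
  slab in which the two metrics are compared, since its length bounds the variation of \<open>s\<close>; its
  image in \<open>\<real>\<^sup>3\<close> gives \<open>\<bar>x - y\<bar> \<le> K d\<close> (lemma \<open>polar_map_le_warped_dist\<close>). Balls of radius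
  \<open>r R\<close> with \<open>r\<close> small are therefore \<open>K\<close>-bilipschitz to Euclidean sets that almost fill a ball,
  and after division by \<open>r\<close> the distortion is at most \<open>8 (K - 1) R\<close>. As \<open>K\<close> is
  arbitrary, this is pointed Gromov--Hausdorff convergence (lemma \<open>tangent_cone_euclidean\<close>).

  It remains to see that the limit function is continuous on \<open>[a, b]\<close>. It is Lipschitz on \<open>[0, D]\<close>,
  and \<open>[a, b] \<subseteq> [0, D]\<close> holds once \<open>f\<close> vanishes at \<open>0\<close> and \<open>D\<close>. The value at \<open>D\<close> is where the
  diameter bound enters: the distance of the two poles of the \<open>j\<close>-th sphere is at least \<open>L\<^sub>j\<close>, so
  \<open>L\<^sub>j \<le> D\<close>.\<close>

section \<open>Admissible curves and their length\<close>

definition warped_path ::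
    "real \<Rightarrow> real \<Rightarrow> (real \<Rightarrow> real) \<Rightarrow> real \<times> (real^3) \<Rightarrow> real \<times> (real^3) \<Rightarrow>
     (real \<Rightarrow> real \<times> (real^3)) \<Rightarrow> bool" where
  "warped_path a b f p q \<gamma> \<longleftrightarrow>
     valid_path \<gamma> \<and> path_image \<gamma> \<subseteq> {a..b} \<times> sphere 0 1 \<and>
     warped_speed f \<gamma> integrable_on {0..1} \<and>
     collapse a b (pathstart \<gamma>) = p \<and> collapse a b (pathfinish \<gamma>) = q"

lemma warped_dist_eq:
  "warped_dist a b f p q =
     Inf ((\<lambda>\<gamma>. integral {0..1} (warped_speed f \<gamma>)) ` {\<gamma>. warped_path a b f p q \<gamma>})"
  unfolding warped_dist_def warped_path_def by (rule arg_cong[where f = Inf]) auto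

lemma warped_speed_nonneg: "0 \<le> warped_speed f \<gamma> t"
  by (simp add: warped_speed_def Let_def)

lemma abs_fst_le_warped_speed: "\<bar>fst (vector_derivative \<gamma> (at t))\<bar> \<le> warped_speed f \<gamma> t"
  by (simp add: warped_speed_def Let_def real_le_rsqrt)

lemma warped_speed_integral_nonneg: "0 \<le> integral {0..1} (warped_speed f \<gamma>)"
  by (cases "warped_speed f \<gamma> integrable_on {0..1}")
     (auto simp: not_integrable_integral intro!: integral_nonneg warped_speed_nonneg)

lemma warped_dist_le:
  assumes "warped_path a b f p q \<gamma>"
  shows "warped_dist a b f p q \<le> integral {0..1} (warped_speed f \<gamma>)"
  unfolding warped_dist_eq using assms
  by (intro cInf_lower bdd_belowI2[where m = 0]) (auto intro: warped_speed_integral_nonneg)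

text \<open>The estimate \<open>\<bar>h \<tau> - h 0\<bar> \<le> \<integral> \<bar>h'\<bar>\<close> in the form in which it applies to images of valid paths:
  finitely many corners are allowed, and the two end points are left out because the two-sided
  derivative there sees the curve outside \<open>[0,1]\<close>, where nothing confines it to the sphere.\<close>

lemma valid_path_displacement_le:
  fixes h :: "real \<Rightarrow> 'a::euclidean_space"
  assumes cont: "continuous_on {0..1} h" and fin: "finite E"
    and deriv: "\<And>t. t \<in> {0<..<1} - E \<Longrightarrow> (h has_vector_derivative h' t) (at t)"
    and w: "w integrable_on {0..1}" "\<And>t. 0 \<le> w t"
    and le: "\<And>t. t \<in> {0<..<1} - E \<Longrightarrow> norm (h' t) \<le> w t"
    and \<tau>: "\<tau> \<in> {0..1}"
  shows "norm (h \<tau> - h 0) \<le> integral {0..1} w"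
proof -
  define k where "k t = (if t \<in> {0<..<1} - E then h' t else 0)" for t
  have k: "(k has_integral (h \<tau> - h 0)) {0..\<tau>}"
  proof (rule fundamental_theorem_of_calculus_interior_strong[OF fin])
    show "0 \<le> \<tau>" using \<tau> by simp
    show "continuous_on {0..\<tau>} h" using \<tau> by (intro continuous_on_subset[OF cont]) auto
    show "(h has_vector_derivative k t) (at t)" if "t \<in> {0<..<\<tau>} - E" for t
      using that \<tau> deriv[of t] by (simp add: k_def)
  qed
  have w\<tau>: "w integrable_on {0..\<tau>}"
    using \<tau> by (intro integrable_on_subinterval[OF w(1)]) auto
  have "norm (integral {0..\<tau>} k) \<le> integral {0..\<tau>} w"
    using k w\<tau> by (intro integral_norm_bound_integral) (auto simp: k_def le w(2) has_integral_integrable)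
  also have "\<dots> \<le> integral {0..1} w"
    using \<tau> w w\<tau> by (intro integral_subset_le) auto
  finally show ?thesis using k by (simp add: integral_unique)
qed

lemma warped_path_derivative:
  assumes "warped_path a b f p q \<gamma>"
  obtains E where "finite E"
    "\<And>t. t \<in> {0<..<1} - E \<Longrightarrow> (\<gamma> has_vector_derivative vector_derivative \<gamma> (at t)) (at t)"
proof -
  from assms obtain E where "finite E" and E: "\<gamma> C1_differentiable_on {0..1} - E"
    unfolding warped_path_def valid_path_def piecewise_C1_differentiable_on_def by blast
  with that[of E] show thesis
    by (auto simp: C1_differentiable_on_eq vector_derivative_works)
qed

lemma warped_path_in:
  assumes "warped_path a b f p q \<gamma>" "t \<in> {0..1}"
  shows "fst (\<gamma> t) \<in> {a..b}" "norm (snd (\<gamma> t)) = 1"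
proof -
  have "\<gamma> t \<in> {a..b} \<times> sphere 0 1"
    using assms by (auto simp: warped_path_def path_image_def)
  then show "fst (\<gamma> t) \<in> {a..b}" "norm (snd (\<gamma> t)) = 1"
    by (auto simp: mem_Times_iff)
qed

lemma warped_path_continuous:
  assumes "warped_path a b f p q \<gamma>"
  shows "continuous_on {0..1} \<gamma>"
  using assms by (auto simp: warped_path_def valid_path_def piecewise_C1_differentiable_on_def)

lemma fst_collapse [simp]: "fst (collapse a b x) = fst x"
  by (simp add: collapse_def split_beta)

text \<open>Since \<open>\<bar>s'\<bar>\<close> is at most the speed, a short curve stays in a thin slab around its starting
  slice. This is what makes the distance near a point depend only on the metric near that point.\<close>

lemma warped_path_fst_le:
  assumes \<gamma>: "warped_path a b f p q \<gamma>" and t: "t \<in> {0..1}"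
  shows "\<bar>fst (\<gamma> t) - fst p\<bar> \<le> integral {0..1} (warped_speed f \<gamma>)"
proof -
  obtain E where E: "finite E"
    "\<And>t. t \<in> {0<..<1} - E \<Longrightarrow> (\<gamma> has_vector_derivative vector_derivative \<gamma> (at t)) (at t)"
    using warped_path_derivative[OF \<gamma>] by blast
  have "norm (fst (\<gamma> t) - fst (\<gamma> 0)) \<le> integral {0..1} (warped_speed f \<gamma>)"
  proof (rule valid_path_displacement_le[OF _ E(1) _ _ _ _ t])
    show "continuous_on {0..1} (\<lambda>t. fst (\<gamma> t))"
      by (intro continuous_intros warped_path_continuous[OF \<gamma>])
    show "((\<lambda>t. fst (\<gamma> t)) has_vector_derivative fst (vector_derivative \<gamma> (at t))) (at t)"
      if "t \<in> {0<..<1} - E" for t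
      using bounded_linear.has_vector_derivative[OF bounded_linear_fst E(2)[OF that]] .
  qed (use \<gamma> in \<open>auto simp: warped_path_def warped_speed_nonneg abs_fst_le_warped_speed\<close>)
  moreover have "fst (\<gamma> 0) = fst p"
    using \<gamma> fst_collapse[of a b "\<gamma> 0"] unfolding warped_path_def pathstart_def by metis
  ultimately show ?thesis by simp
qed

section \<open>Comparison with Euclidean space in polar coordinates\<close>

text \<open>Polar coordinates of \<open>\<real>\<^sup>3\<close>, with the radius shifted by \<open>m\<close>. They are an isometry for the
  warping function \<open>s - m\<close>.\<close>

definition polar_map :: "real \<Rightarrow> real \<times> (real^3) \<Rightarrow> real^3" where
  "polar_map m q = (fst q - m) *\<^sub>R snd q"

lemma norm_radial_tangential:
  fixes \<theta> :: "'a::real_inner"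
  assumes "norm \<theta> = 1" "\<theta> \<bullet> w = 0"
  shows "norm (\<rho> *\<^sub>R w + \<sigma> *\<^sub>R \<theta>) = sqrt (\<sigma>\<^sup>2 + \<rho>\<^sup>2 * (norm w)\<^sup>2)"
  unfolding norm_eq_sqrt_inner using assms
  by (auto simp: inner_add inner_commute norm_eq_1 power2_eq_square algebra_simps)

text \<open>The curve stays where \<open>s - m \<le> K \<bar>f s\<bar>\<close> because it is short, and there the Euclidean speed of its
  image is at most \<open>K\<close> times its own speed.\<close>

lemma warped_path_polar_map_le:
  assumes \<gamma>: "warped_path a b f p q \<gamma>"
    and K: "K \<ge> 1"
    and near: "\<And>s. \<bar>s - s0\<bar> < \<delta> \<Longrightarrow> a < s \<and> s < b \<and> m < s \<and> s - m \<le> K * \<bar>f s\<bar>"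
    and short: "\<bar>fst p - s0\<bar> + integral {0..1} (warped_speed f \<gamma>) < \<delta>"
  shows "norm (polar_map m q - polar_map m p) \<le> K * integral {0..1} (warped_speed f \<gamma>)"
proof -
  obtain E where E: "finite E"
    "\<And>t. t \<in> {0<..<1} - E \<Longrightarrow> (\<gamma> has_vector_derivative vector_derivative \<gamma> (at t)) (at t)"
    using warped_path_derivative[OF \<gamma>] by blast
  have st: "\<bar>fst (\<gamma> t) - s0\<bar> < \<delta>" if "t \<in> {0..1}" for t
    using warped_path_fst_le[OF \<gamma> that] short by linarith
  have ends: "\<gamma> 0 = p" "\<gamma> 1 = q"
    using \<gamma> near[OF st[of 0]] near[OF st[of 1]]
    by (auto simp: warped_path_def pathstart_def pathfinish_def collapse_def split_beta)
  let ?v = "\<lambda>t. vector_derivative \<gamma> (at t)"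
  let ?h' = "\<lambda>t. (fst (\<gamma> t) - m) *\<^sub>R snd (?v t) + fst (?v t) *\<^sub>R snd (\<gamma> t)"
  have "norm (polar_map m (\<gamma> 1) - polar_map m (\<gamma> 0))
          \<le> integral {0..1} (\<lambda>t. K * warped_speed f \<gamma> t)"
  proof (rule valid_path_displacement_le[OF _ E(1)])
    show "continuous_on {0..1} (\<lambda>t. polar_map m (\<gamma> t))" unfolding polar_map_def
      by (intro continuous_intros warped_path_continuous[OF \<gamma>])
    show "(\<lambda>t. K * warped_speed f \<gamma> t) integrable_on {0..1}"
      using \<gamma> integrable_on_mult_right unfolding warped_path_def by blast
    show "0 \<le> K * warped_speed f \<gamma> t" for t using K warped_speed_nonneg[of f \<gamma> t] by simp
    fix t :: real assume t: "t \<in> {0<..<1} - E"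
    have d1: "((\<lambda>t. fst (\<gamma> t)) has_vector_derivative fst (?v t)) (at t)"
      using bounded_linear.has_vector_derivative[OF bounded_linear_fst E(2)[OF t]] .
    have d2: "((\<lambda>t. snd (\<gamma> t)) has_vector_derivative snd (?v t)) (at t)"
      using bounded_linear.has_vector_derivative[OF bounded_linear_snd E(2)[OF t]] .
    have "((\<lambda>t. fst (\<gamma> t) - m) has_real_derivative fst (?v t)) (at t)"
      using d1 by (auto intro!: derivative_eq_intros simp: has_real_derivative_iff_has_vector_derivative)
    from has_vector_derivative_scaleR[OF this d2]
    show "((\<lambda>t. polar_map m (\<gamma> t)) has_vector_derivative ?h' t) (at t)"
      unfolding polar_map_def by simp
    \<comment> \<open>The radial and the spherical part of the velocity are orthogonal, as \<open>\<bar>\<theta>\<bar>\<^sup>2 = 1\<close> near \<open>t\<close>.\<close>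
    have perp: "snd (\<gamma> t) \<bullet> snd (?v t) = 0"
    proof -
      have "((\<lambda>t. snd (\<gamma> t) \<bullet> snd (\<gamma> t)) has_vector_derivative
              snd (\<gamma> t) \<bullet> snd (?v t) + snd (?v t) \<bullet> snd (\<gamma> t)) (at t)"
        using bounded_bilinear.has_vector_derivative[OF bounded_bilinear_inner d2 d2] .
      moreover have "((\<lambda>t. snd (\<gamma> t) \<bullet> snd (\<gamma> t)) has_vector_derivative 0) (at t)"
      proof (rule has_vector_derivative_transform_within_open[where S = "{0<..<1}"])
        show "((\<lambda>t. 1::real) has_vector_derivative 0) (at t)" by simp
        show "1 = snd (\<gamma> u) \<bullet> snd (\<gamma> u)" if "u \<in> {0<..<1}" for u
          using warped_path_in(2)[OF \<gamma>, of u] that by (simp add: norm_eq_1)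
      qed (use t in auto)
      ultimately show ?thesis
        using vector_derivative_unique_at by (fastforce simp: inner_commute)
    qed
    let ?s = "fst (\<gamma> t)"
    have n1: "norm (snd (\<gamma> t)) = 1" using warped_path_in(2)[OF \<gamma>, of t] t by simp
    have near': "0 < ?s - m" "?s - m \<le> K * \<bar>f ?s\<bar>" using near[OF st[of t]] t by auto
    have "norm (?h' t) = sqrt ((fst (?v t))\<^sup>2 + (?s - m)\<^sup>2 * (norm (snd (?v t)))\<^sup>2)"
      by (rule norm_radial_tangential[OF n1 perp])
    also have "\<dots> \<le> sqrt (K\<^sup>2 * ((fst (?v t))\<^sup>2 + (f ?s)\<^sup>2 * (norm (snd (?v t)))\<^sup>2))"
    proof (rule real_sqrt_le_mono)
      have "(?s - m)\<^sup>2 \<le> (K * \<bar>f ?s\<bar>)\<^sup>2" using near' by (intro power_mono) auto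
      then have "(?s - m)\<^sup>2 * (norm (snd (?v t)))\<^sup>2 \<le> (K\<^sup>2 * (f ?s)\<^sup>2) * (norm (snd (?v t)))\<^sup>2"
        by (intro mult_right_mono) (auto simp: power_mult_distrib)
      moreover have "1 * (fst (?v t))\<^sup>2 \<le> K\<^sup>2 * (fst (?v t))\<^sup>2"
        using K by (intro mult_right_mono) (auto simp: one_le_power)
      ultimately show "(fst (?v t))\<^sup>2 + (?s - m)\<^sup>2 * (norm (snd (?v t)))\<^sup>2
          \<le> K\<^sup>2 * ((fst (?v t))\<^sup>2 + (f ?s)\<^sup>2 * (norm (snd (?v t)))\<^sup>2)"
        by (simp add: algebra_simps)
    qed
    also have "\<dots> = K * warped_speed f \<gamma> t"
      using K by (simp add: warped_speed_def Let_def real_sqrt_mult)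
    finally show "norm (?h' t) \<le> K * warped_speed f \<gamma> t" .
  qed simp
  then show ?thesis by (simp add: ends)
qed

lemma polar_pythagoras:
  assumes "x \<noteq> 0"
  shows "(polar_ds x v)\<^sup>2 + (norm x)\<^sup>2 * (norm (polar_dtheta x v))\<^sup>2 = (norm v)\<^sup>2"
proof -
  have sg: "sgn x \<bullet> sgn x = 1" using assms by (metis norm_eq_1 norm_sgn)
  have "norm x *\<^sub>R polar_dtheta x v = v - polar_ds x v *\<^sub>R sgn x"
    using assms by (simp add: polar_dtheta_def polar_ds_def)
  then have "(norm x)\<^sup>2 * (norm (polar_dtheta x v))\<^sup>2 = (norm (v - polar_ds x v *\<^sub>R sgn x))\<^sup>2"
    by (metis norm_scaleR abs_norm_cancel power_mult_distrib)
  also have "\<dots> = (norm v)\<^sup>2 - (polar_ds x v)\<^sup>2"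
    unfolding power2_norm_eq_inner using sg
    by (simp add: polar_ds_def inner_diff inner_commute power2_eq_square algebra_simps)
  finally show ?thesis by simp
qed

lemma has_vector_derivative_norm_curve:
  assumes "(x has_vector_derivative v) (at t)" "x t \<noteq> 0"
  shows "((\<lambda>t. norm (x t)) has_vector_derivative polar_ds (x t) v) (at t)"
proof -
  have "(norm has_derivative (\<lambda>h. polar_ds (x t) h)) (at (x t))"
    using has_derivative_norm[OF assms(2)] by (simp add: polar_ds_def inner_commute)
  from has_derivative_compose[OF assms(1)[unfolded has_vector_derivative_def] this]
  show ?thesis by (simp add: has_vector_derivative_def polar_ds_def)
qed

lemma has_vector_derivative_sgn_curve:
  assumes x: "(x has_vector_derivative v) (at t)" and nz: "x t \<noteq> 0"
  shows "((\<lambda>t. sgn (x t)) has_vector_derivative polar_dtheta (x t) v) (at t)"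
proof -
  have "((\<lambda>t. norm (x t)) has_real_derivative polar_ds (x t) v) (at t)"
    using has_vector_derivative_norm_curve[OF assms]
    by (simp add: has_real_derivative_iff_has_vector_derivative)
  from DERIV_inverse_fun[OF this]
  have "((\<lambda>t. inverse (norm (x t))) has_real_derivative
          - (inverse (norm (x t)) * polar_ds (x t) v * inverse (norm (x t)))) (at t)"
    using nz by (simp add: mult_ac power2_eq_square)
  from has_vector_derivative_scaleR[OF this x] show ?thesis
    unfolding sgn_div_norm
    by (rule has_vector_derivative_eq_rhs)
       (simp add: polar_dtheta_def polar_ds_def sgn_div_norm algebra_simps)
qed

text \<open>Curves on the sphere are obtained by normalising curves in \<open>\<real>\<^sup>3 - {0}\<close>. This single construction
  serves both to connect arbitrary points and to pull back Euclidean segments.\<close>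

lemma polar_curve_warped_path:
  assumes f: "continuous_on {a..b} f"
    and s: "\<And>t. t \<in> {0..1} \<Longrightarrow> (s has_vector_derivative s' t) (at t)" "continuous_on {0..1} s'"
    and x: "\<And>t. t \<in> {0..1} \<Longrightarrow> (x has_vector_derivative x' t) (at t)" "continuous_on {0..1} x'"
    and range: "\<And>t. t \<in> {0..1} \<Longrightarrow> s t \<in> {a..b} \<and> x t \<noteq> 0"
  defines "\<gamma> \<equiv> \<lambda>t. (s t, sgn (x t))"
  shows "warped_path a b f (collapse a b (\<gamma> 0)) (collapse a b (\<gamma> 1)) \<gamma>"
    and "t \<in> {0..1} \<Longrightarrow> warped_speed f \<gamma> t =
           sqrt ((s' t)\<^sup>2 + (f (s t))\<^sup>2 * (norm (polar_dtheta (x t) (x' t)))\<^sup>2)"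
proof -
  let ?v = "\<lambda>t. (s' t, polar_dtheta (x t) (x' t))"
  have d: "(\<gamma> has_vector_derivative ?v t) (at t)" if "t \<in> {0..1}" for t
    unfolding \<gamma>_def using that range
    by (intro has_vector_derivative_Pair has_vector_derivative_sgn_curve s x) auto
  have cs: "continuous_on {0..1} s" 
    using s(1) by (meson continuous_at_imp_continuous_on has_vector_derivative_continuous)
  have cx: "continuous_on {0..1} x" 
    using x(1) by (meson continuous_at_imp_continuous_on has_vector_derivative_continuous)
  have cth: "continuous_on {0..1} (\<lambda>t. polar_dtheta (x t) (x' t))"
    unfolding polar_dtheta_def sgn_div_norm using range
    by (intro continuous_intros cx x(2)) auto
  have speed: "warped_speed f \<gamma> t =
      sqrt ((s' t)\<^sup>2 + (f (s t))\<^sup>2 * (norm (polar_dtheta (x t) (x' t)))\<^sup>2)" if "t \<in> {0..1}" for t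
    unfolding warped_speed_def Let_def vector_derivative_at[OF d[OF that]] by (simp add: \<gamma>_def)
  then show "t \<in> {0..1} \<Longrightarrow> warped_speed f \<gamma> t =
      sqrt ((s' t)\<^sup>2 + (f (s t))\<^sup>2 * (norm (polar_dtheta (x t) (x' t)))\<^sup>2)" .
  have cfs: "continuous_on {0..1} (\<lambda>t. f (s t))"
    by (rule continuous_on_compose2[OF f cs]) (use range in auto)
  have "continuous_on {0..1}
      (\<lambda>t. sqrt ((s' t)\<^sup>2 + (f (s t))\<^sup>2 * (norm (polar_dtheta (x t) (x' t)))\<^sup>2))"
    by (intro continuous_intros s(2) cfs cth)
  then have "continuous_on {0..1} (warped_speed f \<gamma>)"
    by (rule continuous_on_eq) (simp add: speed)
  then have "warped_speed f \<gamma> integrable_on {0..1}"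
    by (rule integrable_continuous_interval)
  moreover have "\<gamma> C1_differentiable_on {0..1}"
    unfolding C1_differentiable_on_def
    using d by (intro exI[of _ ?v] conjI ballI continuous_intros s(2) cth) auto
  then have "valid_path \<gamma>"
    by (simp add: valid_path_def C1_differentiable_imp_piecewise)
  moreover have "path_image \<gamma> \<subseteq> {a..b} \<times> sphere 0 1"
    using range by (auto simp: path_image_def \<gamma>_def norm_sgn)
  ultimately show "warped_path a b f (collapse a b (\<gamma> 0)) (collapse a b (\<gamma> 1)) \<gamma>"
    by (simp add: warped_path_def pathstart_def pathfinish_def)
qed

section \<open>Estimates of the length distance\<close>

text \<open>The distance is an infimum of reals, which says nothing when no admissible curve exists. A
  polynomial curve in \<open>\<real>\<^sup>3 - {0}\<close> supplies the spherical part, also between antipodal points, where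
  a normalised segment would fail.\<close>

lemma warped_path_exists:
  assumes f: "continuous_on {a..b} f" and p: "p \<in> warped_space a b" and q: "q \<in> warped_space a b"
  shows "\<exists>\<gamma>. warped_path a b f p q \<gamma>"
proof -
  obtain s1 \<theta>1 where p': "p = collapse a b (s1, \<theta>1)" "s1 \<in> {a..b}" "norm \<theta>1 = 1"
    using p by (auto simp: warped_space_def)
  obtain s2 \<theta>2 where q': "q = collapse a b (s2, \<theta>2)" "s2 \<in> {a..b}" "norm \<theta>2 = 1"
    using q by (auto simp: warped_space_def)
  have "connected (- {0::real^3})" by (rule connected_punctured_universe) simp
  then obtain x where x: "polynomial_function x" "path_image x \<subseteq> - {0::real^3}"
      "pathstart x = \<theta>1" "pathfinish x = \<theta>2"
    using connected_open_polynomial_connected[of "- {0::real^3}" \<theta>1 \<theta>2] p' q' by fastforce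
  obtain x' where x': "polynomial_function x'" "\<And>t. (x has_vector_derivative x' t) (at t)"
    using has_vector_derivative_polynomial_function[OF x(1)] by blast
  let ?s = "\<lambda>t. s1 + t * (s2 - s1)"
  have "warped_path a b f (collapse a b (?s 0, sgn (x 0))) (collapse a b (?s 1, sgn (x 1)))
      (\<lambda>t. (?s t, sgn (x t)))"
  proof (rule polar_curve_warped_path(1)[OF f, where s' = "\<lambda>t. s2 - s1" and x' = x'])
    show "(?s has_vector_derivative s2 - s1) (at t)" for t
      by (auto intro!: derivative_eq_intros)
    show "continuous_on {0..1} x'" by (rule continuous_on_polymonial_function[OF x'(1)])
    show "?s t \<in> {a..b} \<and> x t \<noteq> 0" if t: "t \<in> {0..1}" for t
    proof -
      have "closed_segment s1 s2 \<subseteq> {a..b}" using p' q' by (intro closed_segment_subset) auto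
      moreover have "?s t \<in> closed_segment s1 s2"
        using t by (auto simp: in_segment algebra_simps intro!: exI[of _ t])
      ultimately show ?thesis using x(2) t by (auto simp: path_image_def)
    qed
  qed (use x' in auto)
  moreover have "sgn (x 0) = \<theta>1" "sgn (x 1) = \<theta>2"
    using x p' q' by (auto simp: pathstart_def pathfinish_def sgn_div_norm)
  ultimately show ?thesis using p' q' by auto
qed

lemma warped_path_of_dist_less:
  assumes "continuous_on {a..b} f" "p \<in> warped_space a b" "q \<in> warped_space a b"
    and "warped_dist a b f p q < l"
  obtains \<gamma> where "warped_path a b f p q \<gamma>" "integral {0..1} (warped_speed f \<gamma>) < l"
proof -
  have "{\<gamma>. warped_path a b f p q \<gamma>} \<noteq> {}" using warped_path_exists[OF assms(1-3)] by blast
  from cInf_lessD[OF _ assms(4)[unfolded warped_dist_eq]] this that show thesis by auto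
qed

lemma fst_diff_le_warped_dist:
  assumes "continuous_on {a..b} f" "p \<in> warped_space a b" "q \<in> warped_space a b"
  shows "\<bar>fst q - fst p\<bar> \<le> warped_dist a b f p q"
proof (rule dense_ge)
  fix l assume "warped_dist a b f p q < l"
  then obtain \<gamma> where \<gamma>: "warped_path a b f p q \<gamma>" "integral {0..1} (warped_speed f \<gamma>) < l"
    using warped_path_of_dist_less[OF assms] by blast
  have "fst (\<gamma> 1) = fst q"
    using \<gamma> fst_collapse[of a b "\<gamma> 1"] unfolding warped_path_def pathfinish_def by metis
  then show "\<bar>fst q - fst p\<bar> \<le> l" using warped_path_fst_le[OF \<gamma>(1), of 1] \<gamma>(2) by simp
qed

text \<open>Curves whose length approximates the distance can be chosen so short that they do not leave the
  slab around \<open>s0\<close>, by the strict inequality in the last assumption.\<close>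

lemma polar_map_le_warped_dist:
  assumes f: "continuous_on {a..b} f" and pq: "p \<in> warped_space a b" "q \<in> warped_space a b"
    and K: "K \<ge> 1"
    and near: "\<And>s. \<bar>s - s0\<bar> < \<delta> \<Longrightarrow> a < s \<and> s < b \<and> m < s \<and> s - m \<le> K * \<bar>f s\<bar>"
    and short: "\<bar>fst p - s0\<bar> + warped_dist a b f p q < \<delta>"
  shows "norm (polar_map m q - polar_map m p) \<le> K * warped_dist a b f p q"
proof (rule dense_ge)
  fix y assume y: "K * warped_dist a b f p q < y"
  \<comment> \<open>The first bound yields the claim up to \<open>y\<close>, the second keeps the curve in the slab.\<close>
  define l where "l = min (y / K) (\<delta> - \<bar>fst p - s0\<bar>)"
  have "warped_dist a b f p q < l"
    using y K short by (simp add: l_def field_simps)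
  then obtain \<gamma> where \<gamma>: "warped_path a b f p q \<gamma>" "integral {0..1} (warped_speed f \<gamma>) < l"
    using warped_path_of_dist_less[OF f pq] by blast
  have "norm (polar_map m q - polar_map m p) \<le> K * integral {0..1} (warped_speed f \<gamma>)"
    by (rule warped_path_polar_map_le[OF \<gamma>(1) K near]) (use \<gamma>(2) in \<open>auto simp: l_def\<close>)
  also have "\<dots> \<le> K * l" using \<gamma>(2) K by (intro mult_left_mono) auto
  also have "\<dots> \<le> y" using K by (simp add: l_def min_def field_simps)
  finally show "norm (polar_map m q - polar_map m p) \<le> y" .
qed

definition polar_inverse :: "real \<Rightarrow> real^3 \<Rightarrow> real \<times> (real^3)" where
  "polar_inverse m x = (m + norm x, sgn x)"

lemma polar_map_inverse [simp]: "polar_map m (polar_inverse m x) = x"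
  by (cases "x = 0") (simp_all add: polar_map_def polar_inverse_def sgn_div_norm)

lemma polar_inverse_map: "m < fst q \<Longrightarrow> norm (snd q) = 1 \<Longrightarrow> polar_inverse m (polar_map m q) = q"
  by (cases q) (simp add: polar_map_def polar_inverse_def sgn_scaleR sgn_div_norm)

text \<open>The ball around \<open>u\<close> is convex, so it contains the segment from \<open>x\<close> to \<open>y\<close>. In polar coordinates
  this segment is an admissible curve, and its speed is at most \<open>K\<close> times the Euclidean one.\<close>

lemma warped_dist_polar_inverse_le:
  assumes f: "continuous_on {a..b} f" and K: "K \<ge> 1" and u: "norm u = s0 - m"
    and near: "\<And>s. \<bar>s - s0\<bar> < \<delta> \<Longrightarrow> a < s \<and> s < b \<and> m < s \<and> \<bar>f s\<bar> \<le> K * (s - m)"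
    and x: "x \<in> ball u \<delta>" and y: "y \<in> ball u \<delta>"
  shows "warped_dist a b f (polar_inverse m x) (polar_inverse m y) \<le> K * norm (y - x)"
proof -
  define z where "z t = x + t *\<^sub>R (y - x)" for t :: real
  have z: "z t \<in> ball u \<delta>" if "t \<in> {0..1}" for t
  proof -
    have "closed_segment x y \<subseteq> ball u \<delta>" using x y by (intro closed_segment_subset) auto
    moreover have "z t \<in> closed_segment x y"
      using that by (auto simp: z_def in_segment algebra_simps intro!: exI[of _ t])
    ultimately show ?thesis by blast
  qed
  have nearz: "a < m + norm (z t) \<and> m + norm (z t) < b \<and> 0 < norm (z t) \<and>
      \<bar>f (m + norm (z t))\<bar> \<le> K * norm (z t)" if t: "t \<in> {0..1}" for t
  proof -
    have "\<bar>norm (z t) - norm u\<bar> < \<delta>"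
      using z[OF t] norm_triangle_ineq3[of "z t" u] by (simp add: dist_norm norm_minus_commute)
    with near[of "m + norm (z t)"] u show ?thesis by (simp add: algebra_simps)
  qed
  have dz: "(z has_vector_derivative y - x) (at t)" for t
    unfolding z_def by (auto intro!: derivative_eq_intros)
  have cz: "continuous_on {0..1} z" unfolding z_def by (intro continuous_intros)
  define \<gamma> where "\<gamma> = (\<lambda>t. (m + norm (z t), sgn (z t)))"
  have ds: "((\<lambda>t. m + norm (z t)) has_vector_derivative polar_ds (z t) (y - x)) (at t)"
    if "t \<in> {0..1}" for t
    using has_vector_derivative_add[OF has_vector_derivative_const
        has_vector_derivative_norm_curve[OF dz, of t], of m] nearz[OF that] by simp
  have cds: "continuous_on {0..1} (\<lambda>t. polar_ds (z t) (y - x))"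
    unfolding polar_ds_def sgn_div_norm using nearz
    by (intro continuous_intros cz) auto
  have rg: "m + norm (z t) \<in> {a..b} \<and> z t \<noteq> 0" if "t \<in> {0..1}" for t
    using nearz[OF that] by auto
  have wp: "warped_path a b f (collapse a b (\<gamma> 0)) (collapse a b (\<gamma> 1)) \<gamma>"
    unfolding \<gamma>_def by (rule polar_curve_warped_path(1)[OF f ds cds dz _ rg]) auto
  have "warped_speed f \<gamma> t \<le> K * norm (y - x)" if t: "t \<in> {0..1}" for t
  proof -
    let ?\<rho> = "norm (z t)" and ?w = "norm (polar_dtheta (z t) (y - x))"
    have "warped_speed f \<gamma> t = sqrt ((polar_ds (z t) (y - x))\<^sup>2 + (f (m + ?\<rho>))\<^sup>2 * ?w\<^sup>2)"
      unfolding \<gamma>_def by (rule polar_curve_warped_path(2)[OF f ds cds dz _ rg t]) auto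
    also have "\<dots> \<le> sqrt (K\<^sup>2 * ((polar_ds (z t) (y - x))\<^sup>2 + ?\<rho>\<^sup>2 * ?w\<^sup>2))"
    proof (rule real_sqrt_le_mono)
      have "\<bar>f (m + ?\<rho>)\<bar>\<^sup>2 \<le> (K * ?\<rho>)\<^sup>2" using nearz[OF t] by (intro power_mono) auto
      then have "(f (m + ?\<rho>))\<^sup>2 * ?w\<^sup>2 \<le> (K\<^sup>2 * ?\<rho>\<^sup>2) * ?w\<^sup>2"
        by (intro mult_right_mono) (auto simp: power_mult_distrib)
      moreover have "1 * (polar_ds (z t) (y - x))\<^sup>2 \<le> K\<^sup>2 * (polar_ds (z t) (y - x))\<^sup>2"
        using K by (intro mult_right_mono) (auto simp: one_le_power)
      ultimately show "(polar_ds (z t) (y - x))\<^sup>2 + (f (m + ?\<rho>))\<^sup>2 * ?w\<^sup>2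
          \<le> K\<^sup>2 * ((polar_ds (z t) (y - x))\<^sup>2 + ?\<rho>\<^sup>2 * ?w\<^sup>2)"
        by (simp add: algebra_simps)
    qed
    also have "\<dots> = K * norm (y - x)"
      using K rg[OF t] polar_pythagoras[of "z t" "y - x"] by (simp add: real_sqrt_mult)
    finally show ?thesis .
  qed
  then have "integral {0..1} (warped_speed f \<gamma>) \<le> integral {0..1} (\<lambda>t::real. K * norm (y - x))"
    using wp by (intro integral_le) (auto simp: warped_path_def)
  moreover have "\<gamma> 0 = polar_inverse m x" "\<gamma> 1 = polar_inverse m y"
    by (auto simp: \<gamma>_def polar_inverse_def z_def)
  moreover have "collapse a b (\<gamma> 0) = \<gamma> 0" "collapse a b (\<gamma> 1) = \<gamma> 1"
    using nearz[of 0] nearz[of 1] by (auto simp: collapse_def \<gamma>_def)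
  ultimately show ?thesis using warped_dist_le[OF wp] by simp
qed

section \<open>Tangent cones at interior points\<close>

text \<open>At \<open>s = s0\<close> both \<open>\<bar>f s\<bar>\<close> and \<open>s - (s0 - \<bar>f s0\<bar>)\<close> are equal to \<open>\<bar>f s0\<bar> > 0\<close>, so the inequalities
  are strict there and persist nearby.\<close>

lemma warping_function_near:
  fixes f :: "real \<Rightarrow> real"
  assumes f: "continuous_on {a..b} f" and s0: "a < s0" "s0 < b" "f s0 \<noteq> 0" and K: "K > 1"
  obtains \<delta> where "\<delta> > 0" and
    "\<And>s. \<bar>s - s0\<bar> < \<delta> \<Longrightarrow> a < s \<and> s < b \<and> s0 - \<bar>f s0\<bar> < s \<and>
       s - (s0 - \<bar>f s0\<bar>) \<le> K * \<bar>f s\<bar> \<and> \<bar>f s\<bar> \<le> K * (s - (s0 - \<bar>f s0\<bar>))"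
proof -
  let ?m = "s0 - \<bar>f s0\<bar>"
  have "isCont f s0"
    using f s0 by (intro continuous_on_interior[OF f]) (auto simp: interior_atLeastAtMost_real)
  then have cf: "(f \<longlongrightarrow> f s0) (at s0)" by (simp add: isCont_def)
  have lf: "((\<lambda>s. K * \<bar>f s\<bar> - (s - ?m)) \<longlongrightarrow> K * \<bar>f s0\<bar> - (s0 - ?m)) (at s0)"
    by (intro tendsto_intros cf)
  have uf: "((\<lambda>s. K * (s - ?m) - \<bar>f s\<bar>) \<longlongrightarrow> K * (s0 - ?m) - \<bar>f s0\<bar>) (at s0)"
    by (intro tendsto_intros cf)
  have "\<forall>\<^sub>F s in at s0. a < s" "\<forall>\<^sub>F s in at s0. s < b" "\<forall>\<^sub>F s in at s0. ?m < s"
    using s0 by (auto intro!: order_tendstoD[OF tendsto_ident_at])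
  moreover have "\<forall>\<^sub>F s in at s0. 0 < K * \<bar>f s\<bar> - (s - ?m)"
    by (rule order_tendstoD(1)[OF lf]) (use s0 K in auto)
  moreover have "\<forall>\<^sub>F s in at s0. 0 < K * (s - ?m) - \<bar>f s\<bar>"
    by (rule order_tendstoD(1)[OF uf]) (use s0 K in auto)
  ultimately have "\<forall>\<^sub>F s in at s0. a < s \<and> s < b \<and> ?m < s \<and>
       s - ?m \<le> K * \<bar>f s\<bar> \<and> \<bar>f s\<bar> \<le> K * (s - ?m)"
    by eventually_elim auto
  moreover have "a < s0 \<and> s0 < b \<and> ?m < s0 \<and>
       s0 - ?m \<le> K * \<bar>f s0\<bar> \<and> \<bar>f s0\<bar> \<le> K * (s0 - ?m)"
    using s0 K by auto
  ultimately have "\<forall>\<^sub>F s in nhds s0. a < s \<and> s < b \<and> ?m < s \<and>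
       s - ?m \<le> K * \<bar>f s\<bar> \<and> \<bar>f s\<bar> \<le> K * (s - ?m)"
    by (auto simp: eventually_nhds_conv_at)
  then show thesis
    using that by (auto simp: eventually_nhds_metric dist_real_def)
qed


text \<open>The approximating map is \<open>y \<mapsto> (polar_map m y - u) / r\<close>, where \<open>u\<close> is the image of the base point.
  It preserves distances up to the factor \<open>K = 1 + \<eta>\<close>.\<close>

lemma tangent_cone_euclidean:
  assumes f: "continuous_on {a..b} f" and s0: "a < s0" "s0 < b" "f s0 \<noteq> 0" and \<theta>0: "norm \<theta>0 = 1"
  shows "is_tangent_cone (warped_space a b) (warped_dist a b f) (s0, \<theta>0) (UNIV :: (real^3) set) dist 0"
  unfolding is_tangent_cone_def pointed_GH_limit_def
proof (intro allI impI)
  fix R \<epsilon> :: real assume R: "0 < R" and \<epsilon>: "0 < \<epsilon>"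
  \<comment> \<open>In a ball of radius \<open>r R\<close> distances are at most \<open>8 r R\<close>, so the rescaled distortion is at most
    \<open>8 R \<eta>\<close>, and this should be at most \<open>\<epsilon> / 2\<close>.\<close>
  define \<eta> where "\<eta> = min 1 (\<epsilon> / (16 * R))"
  define K where "K = 1 + \<eta>"
  have \<eta>: "0 < \<eta>" "\<eta> \<le> 1" "16 * R * \<eta> \<le> \<epsilon>"
    using R \<epsilon> by (auto simp: \<eta>_def min_def field_simps)
  have K: "1 < K" "K \<le> 2" using \<eta> by (auto simp: K_def)
  define m where "m = s0 - \<bar>f s0\<bar>"
  define p where "p = (s0, \<theta>0)"
  define u where "u = polar_map m p"
  obtain \<delta> where \<delta>: "\<delta> > 0" and near: "\<And>s. \<bar>s - s0\<bar> < \<delta> \<Longrightarrow> a < s \<and> s < b \<and> m < s \<and>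
       s - m \<le> K * \<bar>f s\<bar> \<and> \<bar>f s\<bar> \<le> K * (s - m)"
    using warping_function_near[OF f s0 K(1)] unfolding m_def by metis
  have near_lower: "\<And>s. \<bar>s - s0\<bar> < \<delta> \<Longrightarrow> a < s \<and> s < b \<and> m < s \<and> s - m \<le> K * \<bar>f s\<bar>"
    and near_upper: "\<And>s. \<bar>s - s0\<bar> < \<delta> \<Longrightarrow> a < s \<and> s < b \<and> m < s \<and> \<bar>f s\<bar> \<le> K * (s - m)"
    using near by blast+
  have nu: "norm u = s0 - m" using \<theta>0 by (simp add: u_def polar_map_def p_def m_def)
  have pu: "polar_inverse m u = p"
    unfolding u_def using s0 \<theta>0 by (intro polar_inverse_map) (auto simp: p_def m_def)
  let ?M = "warped_space a b" and ?d = "warped_dist a b f"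
  have pM: "p \<in> ?M"
    unfolding warped_space_def using s0 \<theta>0
    by (intro image_eqI[where x = p]) (auto simp: p_def collapse_def)
  have upper: "?d (polar_inverse m x) (polar_inverse m y) \<le> K * norm (y - x)"
    if "x \<in> ball u \<delta>" "y \<in> ball u \<delta>" for x y
    using K that by (intro warped_dist_polar_inverse_le[OF f _ nu near_upper]) auto
  have lower: "norm (polar_map m z - polar_map m y) \<le> K * ?d y z"
    if "y \<in> ?M" "z \<in> ?M" "\<bar>fst y - s0\<bar> + ?d y z < \<delta>" for y z
    using K that by (intro polar_map_le_warped_dist[OF f _ _ _ near_lower]) auto
  \<comment> \<open>For such \<open>r\<close> the bound \<open>8 r R\<close> on distances is below \<open>\<delta> / 2\<close>, as the lower estimate between
    two points of the ball requires.\<close>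
  have "\<forall>\<^sub>F r in at_right 0. r \<in> {0<..<\<delta> / (16 * R)}"
    using R \<delta> by (intro eventually_at_right_real) auto
  then show "\<forall>\<^sub>F r in at_right 0. let B = {y \<in> ?M. ?d (s0, \<theta>0) y / r < R} in
      \<exists>\<phi>. \<phi> ` B \<subseteq> UNIV \<and> \<phi> (s0, \<theta>0) = (0::real^3) \<and>
        (\<exists>\<delta><\<epsilon>. \<forall>y\<in>B. \<forall>z\<in>B. \<bar>dist (\<phi> y) (\<phi> z) - ?d y z / r\<bar> \<le> \<delta>) \<and>
        (\<forall>w\<in>UNIV. dist 0 w < R - \<epsilon> \<longrightarrow> (\<exists>y\<in>B. dist w (\<phi> y) < \<epsilon>))"
  proof eventually_elim
    case (elim r)
    then have r: "0 < r" "16 * (r * R) < \<delta>" using R by (auto simp: field_simps)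
    have rR: "0 < r * R" using r R by simp
    define B where "B = {y \<in> ?M. ?d p y / r < R}"
    have B: "y \<in> B \<longleftrightarrow> y \<in> ?M \<and> ?d p y < r * R" for y
      using r by (auto simp: B_def field_simps)
    define \<phi> where "\<phi> y = (polar_map m y - u) /\<^sub>R r" for y
    have \<phi>_dist: "dist (\<phi> y) (\<phi> z) = norm (polar_map m z - polar_map m y) / r" for y z
    proof -
      have "\<phi> y - \<phi> z = (polar_map m y - polar_map m z) /\<^sub>R r"
        by (simp add: \<phi>_def algebra_simps)
      then show ?thesis using r by (simp add: dist_norm norm_minus_commute divide_inverse mult.commute)
    qed
    have in_B: "\<bar>fst y - s0\<bar> < r * R" "norm (polar_map m y - u) \<le> 2 * (r * R)"
        "polar_map m y \<in> ball u \<delta>" "polar_inverse m (polar_map m y) = y"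
      if y: "y \<in> B" for y
    proof -
      have yM: "y \<in> ?M" and dy: "?d p y < r * R" using y B by auto
      show fy: "\<bar>fst y - s0\<bar> < r * R"
        using fst_diff_le_warped_dist[OF f pM yM] dy by (simp add: p_def)
      have "norm (polar_map m y - u) \<le> K * ?d p y"
        unfolding u_def using dy r rR by (intro lower pM yM) (simp add: p_def)
      also have "\<dots> \<le> 2 * (r * R)"
        using K dy fy fst_diff_le_warped_dist[OF f pM yM] by (intro mult_mono) (auto simp: p_def)
      finally show le: "norm (polar_map m y - u) \<le> 2 * (r * R)" .
      then show "polar_map m y \<in> ball u \<delta>"
        using r rR by (simp add: dist_norm norm_minus_commute)
      have "a < fst y" "fst y < b" "m < fst y" using near[of "fst y"] fy r rR by auto
      moreover from this have "norm (snd y) = 1"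
        using yM by (auto simp: warped_space_def collapse_def)
      ultimately show "polar_inverse m (polar_map m y) = y" by (intro polar_inverse_map)
    qed
    have distortion: "\<bar>dist (\<phi> y) (\<phi> z) - ?d y z / r\<bar> \<le> \<epsilon> / 2" if y: "y \<in> B" and z: "z \<in> B" for y z
    proof -
      let ?N = "norm (polar_map m z - polar_map m y)"
      have N: "?N \<le> 4 * (r * R)"
        using in_B(2)[OF y] in_B(2)[OF z]
          norm_triangle_ineq4[of "polar_map m z - u" "polar_map m y - u"] by simp
      have dN: "?d y z \<le> K * ?N"
        using upper[OF in_B(3)[OF y] in_B(3)[OF z]] in_B(4)[OF y] in_B(4)[OF z] by simp
      also have "\<dots> \<le> 2 * (4 * (r * R))" using K N by (intro mult_mono) auto
      finally have d: "?d y z \<le> 8 * (r * R)" by simp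
      have Nd: "?N \<le> K * ?d y z"
        using d in_B(1)[OF y] r rR y z B by (intro lower) auto
      have "\<eta> * ?d y z \<le> \<eta> * (8 * (r * R))" "\<eta> * ?N \<le> \<eta> * (8 * (r * R))"
        using d N rR \<eta> by (auto intro!: mult_left_mono)
      moreover have "\<eta> * (8 * (r * R)) \<le> r * (\<epsilon> / 2)"
        using mult_left_mono[OF \<eta>(3), of r] r by (simp add: algebra_simps)
      ultimately have "\<bar>?N - ?d y z\<bar> \<le> r * (\<epsilon> / 2)"
        using dN Nd unfolding K_def distrib_right abs_le_iff by linarith
      moreover have "dist (\<phi> y) (\<phi> z) - ?d y z / r = (?N - ?d y z) / r"
        by (simp add: \<phi>_dist diff_divide_distrib)
      ultimately show ?thesis using r by (simp add: pos_divide_le_eq mult.commute)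
    qed
    \<comment> \<open>Each \<open>w\<close> is the exact image of a point; it lies in \<open>B\<close> because \<open>K (R - \<epsilon>) < R\<close>.\<close>
    have dense: "\<exists>y\<in>B. dist w (\<phi> y) < \<epsilon>" if w: "dist 0 w < R - \<epsilon>" for w
    proof -
      let ?x = "u + r *\<^sub>R w"
      let ?y = "polar_inverse m ?x"
      have rw: "norm (r *\<^sub>R w) < r * (R - \<epsilon>)" using w r by simp
      then have "norm (r *\<^sub>R w) < \<delta>"
        using r rR mult_pos_pos[OF r(1) \<epsilon>] by (simp add: algebra_simps)
      then have x: "?x \<in> ball u \<delta>" by (simp add: dist_norm)
      have "\<bar>norm ?x - norm u\<bar> < \<delta>"
        using x norm_triangle_ineq3[of ?x u] by (simp add: dist_norm)
      then have nx: "a < m + norm ?x" "m + norm ?x < b" "0 < norm ?x"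
        using near[of "m + norm ?x"] nu by auto
      then have "?y \<in> ?M"
        unfolding warped_space_def
        by (intro image_eqI[where x = ?y]) (auto simp: polar_inverse_def collapse_def norm_sgn)
      moreover have "?d p ?y < r * R"
      proof -
        have "?d p ?y \<le> K * norm (r *\<^sub>R w)"
          using upper[of u ?x] x \<delta> by (simp add: pu)
        also have "\<dots> \<le> K * (r * (R - \<epsilon>))" using rw K by (intro mult_left_mono) auto
        also have "\<dots> = r * (K * (R - \<epsilon>))" by simp
        also have "\<dots> < r * R"
        proof (rule mult_strict_left_mono[OF _ r(1)])
          have "\<eta> * R < \<epsilon>" using \<eta>(3) mult_pos_pos[OF R \<eta>(1)] by (simp add: mult_ac)
          moreover have "K * (R - \<epsilon>) = R - \<epsilon> + \<eta> * R - \<eta> * \<epsilon>"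
            by (simp add: K_def algebra_simps)
          ultimately show "K * (R - \<epsilon>) < R" using mult_pos_pos[OF \<eta>(1) \<epsilon>] by linarith
        qed
        finally show ?thesis .
      qed
      ultimately have "?y \<in> B" using B by simp
      moreover have "\<phi> ?y = w" using r by (simp add: \<phi>_def)
      ultimately show ?thesis using \<epsilon> by (intro bexI[of _ ?y]) auto
    qed
    have "\<phi> p = 0" by (simp add: \<phi>_def u_def)
    moreover have "\<epsilon> / 2 < \<epsilon>" using \<epsilon> by simp
    ultimately show ?case
      unfolding Let_def p_def[symmetric] B_def[symmetric]
      using distortion dense by (intro exI[of _ \<phi>] conjI exI[of _ "\<epsilon> / 2"]) auto
  qed
qed

section \<open>Almost every point of a warped product\<close>

lemma measurable_spherical_coordinates [measurable]:
  "(\<lambda>(\<phi>, \<psi>). vector [sin \<phi> * cos \<psi>, sin \<phi> * sin \<psi>, cos \<phi>] :: real^3)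
     \<in> borel_measurable borel"
proof (subst borel_measurable_euclidean_space, rule ballI)
  fix e :: "real^3" assume "e \<in> Basis"
  then obtain i where e: "e = axis i 1" by (auto simp: Basis_vec_def)
  have "(\<lambda>x. (vector [sin (fst x) * cos (snd x), sin (fst x) * sin (snd x), cos (fst x)] :: real^3) $ i)
      \<in> borel_measurable borel"
    using exhaust_3[of i]
    by (elim disjE; simp; intro borel_measurable_continuous_onI continuous_intros)
  then show "(\<lambda>x. (\<lambda>(\<phi>, \<psi>). vector [sin \<phi> * cos \<psi>, sin \<phi> * sin \<psi>, cos \<phi>] :: real^3) x \<bullet> e)
      \<in> borel_measurable borel"
    by (simp add: e inner_axis case_prod_unfold)
qed

lemma measurable_spherical_density [measurable]:
  "(\<lambda>(\<phi>, \<psi>). ennreal (indicator ({0..pi} \<times> {0..2*pi}) (\<phi>, \<psi>) * sin \<phi>))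
     \<in> borel_measurable (borel :: (real \<times> real) measure)"
proof -
  have [measurable]: "(\<lambda>x::real \<times> real. sin (fst x)) \<in> borel_measurable borel"
    by (intro borel_measurable_continuous_onI continuous_intros)
  have [measurable]: "{0..pi} \<times> {0..2*pi} \<in> sets (borel :: (real \<times> real) measure)"
    by (intro borel_closed closed_Times) auto
  show ?thesis unfolding split_beta by simp
qed

text \<open>Finiteness makes the product measure accessible to Fubini, so that its null sets can be found
  slicewise.\<close>

lemma finite_measure_sphere: "finite_measure sphere_measure"
  unfolding sphere_measure_def
proof (rule finite_measure.finite_measure_distr)
  let ?g = "\<lambda>(\<phi>, \<psi>). ennreal (indicator ({0..pi} \<times> {0..2*pi}) (\<phi>, \<psi>) * sin \<phi>)"
  let ?Q = "cbox (0, 0) (pi, 2 * pi)"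
  show "finite_measure (density lborel ?g)"
  proof
    have "emeasure (density lborel ?g) (space (density lborel ?g)) = (\<integral>\<^sup>+x. ?g x \<partial>lborel)"
      by (subst emeasure_density) simp_all
    also have "\<dots> \<le> (\<integral>\<^sup>+x. indicator ?Q x \<partial>lborel)"
    proof (intro nn_integral_mono)
      fix x :: "real \<times> real"
      show "?g x \<le> indicator ?Q x"
        by (cases x; cases "x \<in> ?Q") (auto simp: cbox_Pair_eq ennreal_le_1)
    qed
    also have "\<dots> = emeasure lborel ?Q" by simp
    also have "\<dots> < \<infinity>" by (rule emeasure_lborel_cbox_finite)
    finally show "emeasure (density lborel ?g) (space (density lborel ?g)) \<noteq> \<infinity>" by simp
  qed
qed simp

lemma AE_sphere_measure_norm: "AE \<theta> in sphere_measure. norm \<theta> = 1"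
proof -
  have "(sin \<phi> * cos \<psi>)\<^sup>2 + (sin \<phi> * sin \<psi>)\<^sup>2 + (cos \<phi>)\<^sup>2 = 1" for \<phi> \<psi> :: real
    using sin_cos_squared_add[of \<phi>] sin_cos_squared_add2[of \<psi>]
    by (simp add: power_mult_distrib flip: distrib_left)
  then have "norm (vector [sin \<phi> * cos \<psi>, sin \<phi> * sin \<psi>, cos \<phi>] :: real^3) = 1" for \<phi> \<psi>
    by (simp add: norm_vec_def L2_set_def sum_3)
  then show ?thesis
    unfolding sphere_measure_def by (subst AE_distr_iff) (auto simp: split_beta)
qed

text \<open>The density vanishes where \<open>f\<close> does, and the end slices, where points are collapsed, are null
  sets. The intermediate set \<open>Q\<close> of good points is Borel, while the set of points with \<open>P\<close> need not
  be.\<close>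

lemma AE_warped_volumeI:
  assumes f: "continuous_on {a..b} f"
    and P: "\<And>s \<theta>. a < s \<Longrightarrow> s < b \<Longrightarrow> f s \<noteq> 0 \<Longrightarrow> norm \<theta> = 1 \<Longrightarrow> P (s, \<theta>)"
  shows "AE p in warped_volume a b f. P p"
proof -
  interpret S: finite_measure sphere_measure by (rule finite_measure_sphere)
  have sets_S [measurable_cong]: "sets sphere_measure = sets borel"
    by (simp add: sphere_measure_def)
  let ?N = "lborel \<Otimes>\<^sub>M sphere_measure"
  let ?h = "\<lambda>(s, \<theta>::real^3). ennreal (indicator {a..b} s * (f s)\<^sup>2)"
  have [measurable]: "(\<lambda>s. indicator {a..b} s * (f s)\<^sup>2) \<in> borel_measurable borel"
    using borel_measurable_continuous_on_indicator[of "{a..b}" "\<lambda>s. (f s)\<^sup>2"] f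
    by (simp add: continuous_on_power)
  have h [measurable]: "?h \<in> borel_measurable ?N" by measurable
  have col: "collapse a b \<in> measurable (density ?N ?h) borel"
  proof -
    have "collapse a b = (\<lambda>x. (fst x, if a < fst x \<and> fst x < b then snd x else 0))"
      by (auto simp: collapse_def)
    moreover have "\<dots> \<in> borel_measurable ?N"
      by measurable
    ultimately show ?thesis by simp
  qed
  \<comment> \<open>\<open>f\<close> is known to be continuous on \<open>[a, b]\<close> only, so it is multiplied by the indicator of this
    interval to give a Borel function.\<close>
  define Q where "Q = {x. a < fst x \<and> fst x < b \<and> indicator {a..b} (fst x) * (f (fst x))\<^sup>2 \<noteq> 0
                     \<and> norm (snd x :: real^3) = 1}"
  have "Q = {x \<in> space (borel \<Otimes>\<^sub>M borel). a < fst x \<and> fst x < b \<and>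
      indicator {a..b} (fst x) * (f (fst x))\<^sup>2 \<noteq> 0 \<and> norm (snd x :: real^3) = 1}"
    by (auto simp: Q_def space_pair_measure)
  also have "\<dots> \<in> sets (borel \<Otimes>\<^sub>M borel)" by measurable
  finally have Q: "Q \<in> sets borel" unfolding borel_prod .
  have "AE x in ?N. fst x \<noteq> a \<and> fst x \<noteq> b \<and> norm (snd x) = 1"
  proof (rule pair_sigma_finite.AE_pair_measure)
    show "pair_sigma_finite lborel sphere_measure" ..
    show "{x \<in> space ?N. fst x \<noteq> a \<and> fst x \<noteq> b \<and> norm (snd x) = 1} \<in> sets ?N" by measurable
    have "AE s in lborel. s \<noteq> a \<and> s \<noteq> b"
      using AE_lborel_singleton[of a] AE_lborel_singleton[of b] by eventually_elim simp
    then show "AE s in lborel. AE \<theta> in sphere_measure.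
        fst (s, \<theta>) \<noteq> a \<and> fst (s, \<theta>) \<noteq> b \<and> norm (snd (s, \<theta>)) = 1"
      by eventually_elim (use AE_sphere_measure_norm in \<open>simp add: eventually_mono\<close>)
  qed
  then have "AE x in ?N. 0 < ?h x \<longrightarrow> collapse a b x \<in> Q"
    by eventually_elim (auto simp: Q_def collapse_def indicator_def of_bool_def split: if_splits)
  then have "AE x in density ?N ?h. collapse a b x \<in> Q"
    by (subst AE_density[OF h])
  then have "AE x in warped_volume a b f. x \<in> Q"
    unfolding warped_volume_def using Q by (subst AE_distr_iff[OF col]) auto
  then show ?thesis
    by eventually_elim (use P in \<open>force simp: Q_def\<close>)
qed

section \<open>The limit of the spheres\<close>

text \<open>The poles of the sphere are at distance at least \<open>l\<close>, the difference of their coordinates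
  \<open>s\<close>.\<close>

lemma rot_sym_sphere_length_le:
  assumes g: "rot_sym_sphere g l" and diam: "warped_diameter 0 l g \<le> ereal D"
  shows "l \<le> D"
proof -
  obtain F where l: "l > 0" and F: "smooth_on UNIV F" "\<And>s. s \<in> {0..l} \<Longrightarrow> F s = g s"
    using g unfolding rot_sym_sphere_def by blast
  have "F differentiable (at x)" for x
    using F(1) unfolding smooth_on_def by (auto dest: spec[of _ "[]"])
  then have "continuous_on {0..l} F"
    by (meson continuous_at_imp_continuous_on differentiable_imp_continuous_within)
  then have cont: "continuous_on {0..l} g" by (rule continuous_on_eq) (use F in auto)
  have mem: "(0, 0) \<in> warped_space 0 l" "(l, 0) \<in> warped_space 0 l"
    unfolding warped_space_def using l
    by (intro image_eqI[where x = "(0, axis 1 1)"] image_eqI[where x = "(l, axis 1 1)"];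
        simp add: collapse_def)+
  have "ereal l \<le> ereal (warped_dist 0 l g (0, 0) (l, 0))"
    using fst_diff_le_warped_dist[OF cont mem] l by simp
  also have "\<dots> \<le> warped_diameter 0 l g"
    unfolding warped_diameter_def using mem by (intro SUP_upper2[where i = "(0,0)"] SUP_upper) auto
  also note diam
  finally show ?thesis by simp
qed

theorem theorem4p6:
  fixes D A :: real
    and L :: "nat \<Rightarrow> real"
    and f :: "nat \<Rightarrow> real \<Rightarrow> real"
    and r :: "nat \<Rightarrow> nat"
    and f_inf :: "real \<Rightarrow> real"
  assumes "D > 0" and "A > 0"
    and "\<And>j. rot_sym_sphere (f j) (L j)"
    and "\<And>j. warped_diameter 0 (L j) (f j) \<le> ereal D"
    and "\<And>j. nonneg_scalar_curvature (f j) (L j)"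
    and "\<And>j. MinA (f j) (L j) \<ge> ennreal A"
    and "strict_mono r"
    and "uniform_limit {0..D} (\<lambda>j. extend_by_zero (L (r j)) (f (r j))) f_inf sequentially"
    and "1-lipschitz_on {0..D} f_inf"
  shows "let a = left_end D f_inf; b = right_end D f_inf
         in AE p in warped_volume a b f_inf.
              is_tangent_cone (warped_space a b) (warped_dist a b f_inf) p
                (UNIV :: (real^3) set) dist 0"
proof -
  have ends: "extend_by_zero (L (r j)) (f (r j)) 0 = 0" 
      "extend_by_zero (L (r j)) (f (r j)) D = 0" for j
    using assms(3)[of "r j"] rot_sym_sphere_length_le[OF assms(3,4), of "r j"]
    by (auto simp: extend_by_zero_def rot_sym_sphere_def)
  have zero: "f_inf s = 0" if "s \<in> {0..D}" "\<And>j. extend_by_zero (L (r j)) (f (r j)) s = 0" for s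
    using tendsto_uniform_limitI[OF assms(8) that(1)] by (simp add: that(2) LIMSEQ_const_iff)
  have f0: "f_inf 0 = 0" and fD: "f_inf D = 0"
    using zero[of 0] zero[of D] ends assms(1) by auto
  \<comment> \<open>The zeros make the two sets below nonempty; the supremum or infimum of an empty set of reals is
    an unspecified number.\<close>
  have "0 \<le> left_end D f_inf"
    unfolding left_end_def using assms(1) f0 by (intro cSup_upper bdd_aboveI[of _ D]) auto
  moreover have "right_end D f_inf \<le> D"
    unfolding right_end_def using assms(1) fD by (intro cInf_lower bdd_belowI[of _ 0]) auto
  ultimately have "continuous_on {left_end D f_inf..right_end D f_inf} f_inf"
    by (intro continuous_on_subset[OF lipschitz_on_continuous_on[OF assms(9)]]) auto
  then show ?thesis
    unfolding Let_def by (intro AE_warped_volumeI tangent_cone_euclidean)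
qed

end
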